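(* For $n\ge 4$ let $m(n)$ be the minimum of $\operatorname{th}_{\operatorname{Z}}(G)\cdot\operatorname{th}_{\operatorname{Z}}(\overline G)$ over all graphs $G$ of order $n$, and let $m_c(n)$ be the minimum of the same product over all graphs $G$ of order $n$ such that both $G$ and its complement $\overline G$ are connected. Then $m(n)=\Theta(n^{3/2})$ and $m_c(n)=\Theta(n^{3/2})$.
   Context: Graphs are finite, simple, undirected, with nonempty vertex set; the order of $G$ is $|V(G)|$; $\overline G$ is the complement of $G$. Standard zero forcing: each vertex is filled or unfilled. Color change rule: if $w$ is the unique unfilled neighbor of a filled vertex $v$, then fill $w$. For $B\subseteq V(G)$ put $B^{[0]}=B$, and let $B^{[i+1]}$ be $B^{[i]}$ together with all vertices that can be filled by one application of the rule when exactly the vertices of $B^{[i]}$ are filled. $\operatorname{pt}_{\operatorname{Z}}(G;B)$ is the least $t$ with $B^{[t]}=V(G)$ ($\infty$ if none exists), and $\operatorname{pt}_{\operatorname{Z}}(G,k)=\min_{|B|=k}\operatorname{pt}_{\operatorname{Z}}(G;B)$. The sum throttling number of $G$ of order $n$ is $\operatorname{th}_{\operatorname{Z}}(G)=\min_{1\le k\le n}(k+\operatorname{pt}_{\operatorname{Z}}(G,k))$. $f=\Theta(g)$ means there are positive constants $c,C,k$ with $c\,g(n)\le f(n)\le C\,g(n)$ for all $n\ge k$. *)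

theory Defs
  imports
    Complex_Main
    "HOL-Library.Extended_Nat"
    "HOL-Library.Landau_Symbols"
    "Graph_Theory.Digraph_Component"
begin

text \<open>
  Finite simple undirected graphs are the symmetric loop-free pair digraphs of \<^locale>\<open>pair_graph\<close>.
  That locale admits the null graph, which has order 0 and hence plays no role for positive orders.
\<close>

definition complement :: "'a pair_pre_digraph \<Rightarrow> 'a pair_pre_digraph" where
  "complement G = \<lparr> pverts = pverts G,
     parcs = {(u, v). u \<in> pverts G \<and> v \<in> pverts G \<and> u \<noteq> v \<and> (u, v) \<notin> parcs G} \<rparr>"

subsection \<open>Standard zero forcing and sum throttling\<close>

definition can_fill :: "'a pair_pre_digraph \<Rightarrow> 'a set \<Rightarrow> 'a \<Rightarrow> 'a \<Rightarrow> bool" where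
  "can_fill G B v w \<longleftrightarrow> v \<in> B \<and> {x. (v, x) \<in> parcs G \<and> x \<notin> B} = {w}"

definition zf_step :: "'a pair_pre_digraph \<Rightarrow> 'a set \<Rightarrow> 'a set" where
  "zf_step G B = B \<union> {w. \<exists>v. can_fill G B v w}"

definition zf_iter :: "'a pair_pre_digraph \<Rightarrow> 'a set \<Rightarrow> nat \<Rightarrow> 'a set" where
  "zf_iter G B i = (zf_step G ^^ i) B"

text \<open>In the complete linear order \<^typ>\<open>enat\<close>, the infimum of a nonempty set is its minimum and
  the infimum of the empty set is \<open>\<infinity>\<close>.\<close>

definition pt_set :: "'a pair_pre_digraph \<Rightarrow> 'a set \<Rightarrow> enat" where
  "pt_set G B = (INF t \<in> {t. zf_iter G B t = pverts G}. enat t)"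

definition pt :: "'a pair_pre_digraph \<Rightarrow> nat \<Rightarrow> enat" where
  "pt G k = (INF B \<in> {B. B \<subseteq> pverts G \<and> card B = k}. pt_set G B)"

definition th :: "'a pair_pre_digraph \<Rightarrow> enat" where
  "th G = (INF k \<in> {1..card (pverts G)}. enat k + pt G k)"

subsection \<open>Minimum throttling products\<close>

text \<open>Every finite graph is isomorphic to one whose vertices are natural numbers, so it is no
  restriction to take the minima over graphs with vertices in \<^typ>\<open>nat\<close>.\<close>

definition graphs_of_order :: "nat \<Rightarrow> nat pair_pre_digraph set" where
  "graphs_of_order n = {G. pair_graph G \<and> card (pverts G) = n}"

definition min_prod :: "nat \<Rightarrow> enat" where
  "min_prod n = (INF G \<in> graphs_of_order n. th G * th (complement G))"

definition min_prod_conn :: "nat \<Rightarrow> enat" where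
  "min_prod_conn n =
     (INF G \<in> {G \<in> graphs_of_order n.
                Digraph_Component.connected G \<and> Digraph_Component.connected (complement G)}.
        th G * th (complement G))"

subsection \<open>Well-definedness\<close>

lemma pair_graph_complement:
  assumes "pair_graph G" shows "pair_graph (complement G)"
proof -
  interpret pair_graph G by fact
  have "parcs (complement G) \<subseteq> pverts G \<times> pverts G" by (auto simp: complement_def)
  then have "finite (parcs (complement G))"
    using pair_finite_verts by (meson finite_SigmaI finite_subset)
  then show ?thesis
    by unfold_locales
      (auto simp: complement_def pair_finite_verts symmetric_def sym_def intro: arcs_symmetric)
qed

lemma complement_complement:
  assumes "pair_graph G" shows "complement (complement G) = G"
proof -
  interpret pair_graph G by fact
  show ?thesis
    by (rule pair_pre_digraph.equality)
      (auto simp: complement_def dest: in_arcsD1 in_arcsD2 no_loops')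
qed

lemma th_finite:
  assumes "finite (pverts G)" "pverts G \<noteq> {}" shows "th G \<noteq> \<infinity>"
proof -
  let ?n = "card (pverts G)"
  have "pt_set G (pverts G) \<le> enat 0"
    unfolding pt_set_def by (rule INF_lower) (auto simp: zf_iter_def)
  moreover have "pt G ?n \<le> pt_set G (pverts G)"
    unfolding pt_def by (rule INF_lower) auto
  ultimately have "pt G ?n = 0" by (simp add: zero_enat_def[symmetric])
  moreover have "?n \<in> {1..?n}" using assms by (simp add: Suc_leI card_gt_0_iff)
  then have "th G \<le> enat ?n + pt G ?n"
    unfolding th_def by (rule INF_lower)
  ultimately show ?thesis by (cases "th G") auto
qed

lemma connected_pairI:
  assumes "pair_graph G" "r \<in> pverts G" "\<And>v. v \<in> pverts G \<Longrightarrow> r \<rightarrow>\<^sup>*\<^bsub>with_proj G\<^esub> v"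
  shows "Digraph_Component.connected (with_proj G)"
proof -
  interpret pair_graph G by fact
  have "strongly_connected (with_proj G)"
  proof (rule strongly_connectedI)
    show "verts (with_proj G) \<noteq> {}" using assms(2) by auto
    show "u \<rightarrow>\<^sup>*\<^bsub>with_proj G\<^esub> v" if "u \<in> verts (with_proj G)" "v \<in> verts (with_proj G)" for u v
      using that assms(3) symmetric_reachable[OF sym_arcs] reachable_trans
      by (metis with_proj_simps(1))
  qed
  then show ?thesis
    using reachable_mk_symmetricI
    by (intro connectedI) (auto simp: strongly_connected_def)
qed

lemma connected_graphs_exist:
  assumes "n \<ge> 4"
  obtains G where "G \<in> graphs_of_order n" "Digraph_Component.connected (with_proj G)"
    "Digraph_Component.connected (with_proj (complement G))"
proof -
  define G where "G = \<lparr> pverts = {..<n},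
    parcs = {(i, j). i < n \<and> j < n \<and> (j = Suc i \<or> i = Suc j)} \<rparr>"
  have "parcs G \<subseteq> {..<n} \<times> {..<n}" by (auto simp: G_def)
  then have "finite (parcs G)" by (meson finite_SigmaI finite_lessThan finite_subset)
  then have G: "pair_graph G"
    by unfold_locales (auto simp: G_def symmetric_def sym_def)
  interpret G: pair_graph G by (rule G)
  interpret H: pair_graph "complement G" by (rule pair_graph_complement[OF G])
  have "0 \<rightarrow>\<^sup>*\<^bsub>with_proj G\<^esub> v" if "v < n" for v
    using that
  proof (induction v)
    case 0
    then show ?case by (intro G.reachable_refl) (auto simp: G_def)
  next
    case (Suc v)
    then have "v \<rightarrow>\<^bsub>with_proj G\<^esub> Suc v" by (auto simp: G_def)
    with Suc show ?case using G.reachable_adj_trans by auto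
  qed
  then have "Digraph_Component.connected (with_proj G)"
    using assms by (intro connected_pairI[OF G, of 0]) (auto simp: G_def)
  moreover have "0 \<rightarrow>\<^sup>*\<^bsub>with_proj (complement G)\<^esub> v" if "v < n" for v
  proof -
    consider "v = 0" | "v = 1" | "v \<ge> 2" by linarith
    then show ?thesis
    proof cases
      case 1
      then have "v \<in> pverts (complement G)" using that by (simp add: complement_def G_def)
      then show ?thesis unfolding 1 by (rule H.reachable_refl)
    next
      case 2
      have arcs: "(0, 3) \<in> parcs (complement G)" "(3, 1) \<in> parcs (complement G)"
        using assms by (auto simp: complement_def G_def)
      show ?thesis unfolding 2
        by (rule H.reachable_adj_trans[OF H.reachable_adjI[OF arcs(1)] arcs(2)])
    next
      case 3
      then have "0 \<rightarrow>\<^bsub>with_proj (complement G)\<^esub> v"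
        using that by (auto simp: complement_def G_def)
      then show ?thesis by (intro H.reachable_adjI) simp
    qed
  qed
  then have "Digraph_Component.connected (with_proj (complement G))"
    using assms
    by (intro connected_pairI[OF pair_graph_complement[OF G], of 0]) (auto simp: complement_def G_def)
  moreover have "G \<in> graphs_of_order n"
    using G by (simp add: graphs_of_order_def) (simp add: G_def)
  ultimately show thesis using that by blast
qed

text \<open>For \<open>n \<ge> 4\<close> the minima range over nonempty families, and their values are finite.\<close>

lemma min_prod_conn_finite:
  assumes "n \<ge> 4" shows "min_prod_conn n \<noteq> \<infinity>"
proof -
  obtain G where G: "G \<in> graphs_of_order n" "Digraph_Component.connected (with_proj G)"
    "Digraph_Component.connected (with_proj (complement G))"
    using connected_graphs_exist[OF assms] .
  then have "finite (pverts G)" "pverts G \<noteq> {}"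
    using assms unfolding graphs_of_order_def by (auto intro: card_ge_0_finite)
  then have "th G \<noteq> \<infinity>" "th (complement G) \<noteq> \<infinity>"
    using th_finite[of G] th_finite[of "complement G"] by (simp_all add: complement_def)
  then have "th G * th (complement G) \<noteq> \<infinity>" by (simp add: imult_is_infinity)
  moreover have "min_prod_conn n \<le> th G * th (complement G)"
    unfolding min_prod_conn_def using G by (intro INF_lower) auto
  ultimately show ?thesis by (metis enat_ord_simps(5))
qed

lemma min_prod_finite:
  assumes "n \<ge> 4" shows "min_prod n \<noteq> \<infinity>"
proof -
  have "min_prod n \<le> min_prod_conn n"
    unfolding min_prod_def min_prod_conn_def by (rule INF_superset_mono) auto
  then show ?thesis using min_prod_conn_finite[OF assms]
    by (metis enat_ord_simps(5))
qed

end

theory Submission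
  imports Defs
begin

text \<open>
  Call a filled vertex \<^emph>\<open>active\<close> if it has an unfilled neighbour. A step of the process deactivates
  every forcing vertex, so the number of active vertices never exceeds \<open>k = |B|\<close>, and each step fills
  at most \<open>k\<close> vertices. Hence \<open>n \<le> k (1 + t)\<close>, which gives \<open>th G \<ge> sqrt n\<close>. Stopping the process
  when half of the vertices are filled and deleting the active vertices leaves two sets of size at
  least \<open>n/2 - k\<close> without edges between them. Such separations of \<open>G\<close> and of its complement are
  incompatible unless \<open>2 (k + k') \<ge> n\<close>, so one of the two throttling numbers is at least \<open>n/4\<close>.
  The order of magnitude is attained by the path, whose throttling number is \<open>O(sqrt n)\<close>: fill
  pairs of consecutive vertices at distance about \<open>sqrt n\<close>.
\<close>

subsection \<open>Active vertices\<close>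

definition active :: "'a pair_pre_digraph \<Rightarrow> 'a set \<Rightarrow> 'a set" where
  "active G S = {v \<in> S. \<exists>x. (v, x) \<in> parcs G \<and> x \<notin> S}"

lemma zf_iter_0 [simp]: "zf_iter G B 0 = B"
  by (simp add: zf_iter_def)

lemma zf_iter_Suc: "zf_iter G B (Suc i) = zf_step G (zf_iter G B i)"
  by (simp add: zf_iter_def)

text \<open>Choose one forcing vertex \<open>f w\<close> for every newly filled \<open>w\<close>. A
  forcing vertex has exactly one unfilled neighbour, so \<open>f\<close> is injective; it is active
  before the step and inactive after it. The new vertices can therefore at worst replace their
  forcing vertices in the active set.\<close>

lemma card_active_zf_step:
  assumes "finite S"
  shows "finite (zf_step G S)"
    and "card (zf_step G S) \<le> card S + card (active G S)"
    and "card (active G (zf_step G S)) \<le> card (active G S)"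
proof -
  define N where "N = zf_step G S - S"
  define f where "f w = (SOME v. can_fill G S v w)" for w
  have f: "can_fill G S (f w) w" if "w \<in> N" for w
    using that unfolding N_def f_def zf_step_def by (auto intro: someI)
  have inj: "inj_on f N"
  proof (rule inj_onI)
    fix x y assume "x \<in> N" "y \<in> N" "f x = f y"
    then have "{x} = {y}"
      using f[of x] f[of y] by (simp add: can_fill_def)
    then show "x = y" by simp
  qed
  have sub: "f ` N \<subseteq> active G S"
    using f unfolding can_fill_def active_def by blast
  have finA: "finite (active G S)"
    using assms by (simp add: active_def)
  have finN: "finite N"
    using inj sub finA by (meson finite_imageD finite_subset)
  have cN: "card N = card (f ` N)"
    using inj by (simp add: card_image)
  then have cN_le: "card N \<le> card (active G S)"
    using sub finA by (simp add: card_mono)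
  have step: "zf_step G S = S \<union> N"
    unfolding N_def zf_step_def by auto
  show "finite (zf_step G S)"
    using step assms finN by simp
  show "card (zf_step G S) \<le> card S + card (active G S)"
    using card_Un_le[of S N] cN_le step by simp
  have "v \<notin> f ` N" if v: "v \<in> active G (zf_step G S)" "v \<in> S" for v
  proof
    assume "v \<in> f ` N"
    then obtain w where w: "w \<in> N" "v = f w" by auto
    then have eq: "{x. (v, x) \<in> parcs G \<and> x \<notin> S} = {w}"
      using f[of w] by (simp add: can_fill_def)
    obtain x where x: "(v, x) \<in> parcs G" "x \<notin> S" "x \<notin> N"
      using v(1) step by (auto simp: active_def)
    then have "x \<in> {w}"
      unfolding eq[symmetric] by simp
    then show False
      using w(1) x(3) by simp
  qed
  then have "active G (zf_step G S) \<subseteq> (active G S - f ` N) \<union> N"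
    using step unfolding active_def by blast
  then have "card (active G (zf_step G S)) \<le> card ((active G S - f ` N) \<union> N)"
    using finA finN by (intro card_mono) auto
  also have "\<dots> \<le> card (active G S - f ` N) + card N"
    by (rule card_Un_le)
  also have "\<dots> = card (active G S)"
    using sub finA finN cN cN_le by (simp add: card_Diff_subset)
  finally show "card (active G (zf_step G S)) \<le> card (active G S)" .
qed

lemma zf_iter_finite_card_active:
  assumes "finite B"
  shows "finite (zf_iter G B i) \<and> card (active G (zf_iter G B i)) \<le> card B"
proof (induction i)
  case 0
  then show ?case
    using assms by (auto simp: active_def intro: card_mono)
next
  case (Suc i)
  then show ?case
    using card_active_zf_step[of "zf_iter G B i" G] by (auto simp: zf_iter_Suc)
qed

lemma card_zf_iter_Suc:
  assumes "finite B"
  shows "card (zf_iter G B (Suc i)) \<le> card (zf_iter G B i) + card B"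
  using zf_iter_finite_card_active[OF assms, of G i] card_active_zf_step(2)[of "zf_iter G B i" G]
  by (simp add: zf_iter_Suc)

lemma card_zf_iter:
  assumes "finite B"
  shows "card (zf_iter G B t) \<le> card B * (1 + t)"
proof (induction t)
  case (Suc t)
  then show ?case using card_zf_iter_Suc[OF assms, of G t] by simp
qed simp

lemma zf_iter_subset:
  assumes "pair_graph G" "B \<subseteq> pverts G"
  shows "zf_iter G B i \<subseteq> pverts G"
proof -
  interpret pair_graph G by fact
  show ?thesis
  proof (induction i)
    case (Suc i)
    then show ?case
      unfolding zf_iter_Suc zf_step_def can_fill_def by (auto dest: in_arcsD2)
  qed (use assms in simp)
qed

subsection \<open>Separations\<close>

text \<open>At any time a filled inactive vertex has no unfilled neighbour, so the active vertices
  \<open>D\<close> separate the remaining filled vertices \<open>A\<close> from the unfilled ones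
  \<open>C\<close>. The time is chosen to balance \<open>A\<close> and \<open>C\<close>.\<close>

lemma zf_separation:
  assumes "pair_graph G" "B \<subseteq> pverts G" "zf_iter G B t = pverts G"
  obtains A C D where "pverts G = A \<union> C \<union> D" "A \<inter> C = {}" "card D \<le> card B"
    "\<And>x y. x \<in> A \<Longrightarrow> y \<in> C \<Longrightarrow> (x, y) \<notin> parcs G"
    "card (pverts G) \<le> 2 * (card A + card B)" "card (pverts G) \<le> 2 * (card C + card B)"
proof -
  interpret pair_graph G by fact
  let ?n = "card (pverts G)"
  have finB: "finite B"
    by (rule finite_subset[OF assms(2) pair_finite_verts])
  \<comment> \<open>The first time at which at least half of the vertices are filled; it exists
    because time \<open>t\<close> qualifies.\<close>
  define i where "i = (LEAST i. ?n \<le> 2 * card (zf_iter G B i))"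
  define S where "S = zf_iter G B i"
  have ge: "?n \<le> 2 * card S"
    using LeastI[of "\<lambda>i. ?n \<le> 2 * card (zf_iter G B i)" t] assms(3)
    by (simp add: S_def i_def)
  have le: "2 * card S \<le> ?n + 2 * card B"
  proof (cases i)
    case 0
    then show ?thesis by (simp add: S_def)
  next
    case (Suc j)
    then have "\<not> ?n \<le> 2 * card (zf_iter G B j)"
      using not_less_Least[of j "\<lambda>i. ?n \<le> 2 * card (zf_iter G B i)"] by (simp add: i_def)
    then show ?thesis
      using card_zf_iter_Suc[OF finB, of G j] Suc by (simp add: S_def)
  qed
  have SV: "S \<subseteq> pverts G"
    unfolding S_def by (rule zf_iter_subset[OF assms(1,2)])
  have S: "finite S" "card (active G S) \<le> card B"
    using zf_iter_finite_card_active[OF finB, of G i] by (auto simp: S_def)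
  have sub: "active G S \<subseteq> S" by (auto simp: active_def)
  show thesis
  proof
    show "pverts G = (S - active G S) \<union> (pverts G - S) \<union> active G S"
      using sub SV by blast
    show "(S - active G S) \<inter> (pverts G - S) = {}" by blast
    show "card (active G S) \<le> card B" by fact
    show "(x, y) \<notin> parcs G" if "x \<in> S - active G S" "y \<in> pverts G - S" for x y
      using that by (auto simp: active_def)
    have "card S \<le> card (S - active G S) + card (active G S)"
      using card_Un_le[of "S - active G S" "active G S"] sub by (simp add: Un_absorb2)
    then show "?n \<le> 2 * (card (S - active G S) + card B)"
      using ge S(2) by simp
    have "?n \<le> card (pverts G - S) + card S"
      using card_Un_le[of "pverts G - S" S] SV by (simp add: Un_absorb2)
    then show "?n \<le> 2 * (card (pverts G - S) + card B)"
      using le by simp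
  qed
qed

text \<open>Take separations \<open>A\<close>, \<open>C\<close>, \<open>D\<close> of the graph and
  \<open>A'\<close>, \<open>C'\<close>, \<open>D'\<close> of its complement. Two distinct vertices
  are adjacent in one of the two graphs, which limits how the large sides can intersect. If the
  bound failed, no large side would fit into the separator of the other graph, and these facts
  clash.\<close>

lemma card_zf_sets_complement:
  assumes "pair_graph G"
    and "B \<subseteq> pverts G" "zf_iter G B t = pverts G"
    and "B' \<subseteq> pverts G" "zf_iter (complement G) B' t' = pverts G"
  shows "card (pverts G) \<le> 2 * (card B + card B')"
proof (rule ccontr)
  assume less: "\<not> ?thesis"
  interpret pair_graph G by fact
  have V: "pverts (complement G) = pverts G" by (simp add: complement_def)
  obtain A C D where S: "pverts G = A \<union> C \<union> D" "A \<inter> C = {}" "card D \<le> card B"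
    "\<And>x y. x \<in> A \<Longrightarrow> y \<in> C \<Longrightarrow> (x, y) \<notin> parcs G"
    "card (pverts G) \<le> 2 * (card A + card B)" "card (pverts G) \<le> 2 * (card C + card B)"
    using zf_separation[OF assms(1-3)] by metis
  obtain A' C' D' where S': "pverts G = A' \<union> C' \<union> D'" "A' \<inter> C' = {}" "card D' \<le> card B'"
    "\<And>x y. x \<in> A' \<Longrightarrow> y \<in> C' \<Longrightarrow> (x, y) \<notin> parcs (complement G)"
    "card (pverts G) \<le> 2 * (card A' + card B')" "card (pverts G) \<le> 2 * (card C' + card B')"
    using zf_separation[OF pair_graph_complement[OF assms(1)], of B' t'] assms(4,5)
    unfolding V by metis
  have fin: "finite A" "finite C" "finite D" "finite A'" "finite C'" "finite D'"
    using pair_finite_verts[unfolded S(1)] pair_finite_verts[unfolded S'(1)] by simp_all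
  \<comment> \<open>A large side has at least n/2 - l vertices, which exceeds k by the assumption
    \<open>less\<close>.\<close>
  have not_sub: "\<not> X \<subseteq> Y" if "card Y \<le> k" "card (pverts G) \<le> 2 * (card X + l)" "k + l \<le> card B + card B'"
    "finite Y" for X Y and k l :: nat
  proof
    assume "X \<subseteq> Y"
    then have "card X \<le> card Y" using that(4) by (rule card_mono[rotated])
    then show False using that(1-3) less by simp
  qed
  have ns: "\<not> A \<subseteq> D'" "\<not> C \<subseteq> D'" "\<not> A' \<subseteq> D" "\<not> C' \<subseteq> D"
    by (rule not_sub[OF S'(3) S(5)] not_sub[OF S'(3) S(6)] not_sub[OF S(3) S'(5)]
        not_sub[OF S(3) S'(6)]; use fin in simp)+
  have edge: "x = y \<or> (x, y) \<in> parcs G \<or> (x, y) \<in> parcs (complement G)"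
    if "x \<in> pverts G" "y \<in> pverts G" for x y
    using that by (auto simp: complement_def)
  have sym: "(y, x) \<in> parcs G" if "(x, y) \<in> parcs G" for x y
    using that arcs_symmetric by blast
  \<comment> \<open>Members x and y of the two intersections would be distinct, yet adjacent neither
    in \<open>G\<close> nor in its complement.\<close>
  have 1: "A \<inter> A' = {} \<or> C \<inter> C' = {}"
    using S(1,2,4) S'(4) edge by blast
  have 2: "A \<inter> C' = {} \<or> C \<inter> A' = {}"
    using S(1,2,4) S'(4) edge sym by blast
  \<comment> \<open>Each of the four combinations of \<open>1\<close> and \<open>2\<close> makes one
    large side disjoint from both large sides of the other separation, hence contained in the other
    separator, contrary to \<open>ns\<close>.\<close>
  show False
    using 1 2 ns S(1) S'(1) by blast
qed

subsection \<open>Throttling numbers\<close>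

lemma Inf_enat_mem:
  fixes A :: "enat set"
  assumes "A \<noteq> {}"
  shows "Inf A \<in> A"
  using assms unfolding Inf_enat_def by (auto intro: LeastI)

lemma th_le:
  assumes "finite (pverts G)" "B \<subseteq> pverts G" "B \<noteq> {}" "zf_iter G B t = pverts G"
  shows "th G \<le> enat (card B + t)"
proof -
  have "finite B" by (rule finite_subset[OF assms(2,1)])
  then have "card B \<in> {1..card (pverts G)}"
    using assms by (simp add: card_mono Suc_leI card_gt_0_iff)
  then have "th G \<le> enat (card B) + pt G (card B)"
    unfolding th_def by (rule INF_lower)
  also have "pt G (card B) \<le> pt_set G B"
    unfolding pt_def using assms by (intro INF_lower) auto
  also have "pt_set G B \<le> enat t"
    unfolding pt_set_def using assms by (intro INF_lower) auto
  finally show ?thesis by (simp add: add_left_mono)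
qed

lemma th_attained:
  assumes "finite (pverts G)" "pverts G \<noteq> {}"
  obtains B t where "B \<subseteq> pverts G" "B \<noteq> {}" "zf_iter G B t = pverts G" "th G = enat (card B + t)"
proof -
  have "{1..card (pverts G)} \<noteq> {}"
    using assms by (simp add: Suc_leI card_gt_0_iff)
  then have "th G \<in> (\<lambda>k. enat k + pt G k) ` {1..card (pverts G)}"
    unfolding th_def by (intro Inf_enat_mem) simp
  then obtain k where k: "k \<in> {1..card (pverts G)}" "th G = enat k + pt G k" by auto
  then have pt_fin: "pt G k \<noteq> \<infinity>"
    using th_finite[OF assms] by (cases "pt G k") auto
  obtain B0 where "B0 \<subseteq> pverts G" "card B0 = k"
    using k(1) obtain_subset_with_card_n by (metis atLeastAtMost_iff)
  then have "pt G k \<in> pt_set G ` {B. B \<subseteq> pverts G \<and> card B = k}"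
    unfolding pt_def by (intro Inf_enat_mem) auto
  then obtain B where B: "B \<subseteq> pverts G" "card B = k" "pt G k = pt_set G B" by auto
  \<comment> \<open>An empty infimum would be \<infinity>, which the finiteness of
    \<open>pt G k\<close> excludes.\<close>
  have "{t. zf_iter G B t = pverts G} \<noteq> {}"
  proof
    assume "{t. zf_iter G B t = pverts G} = {}"
    then show False
      using pt_fin B(3) by (simp add: pt_set_def top_enat_def)
  qed
  then have "pt_set G B \<in> enat ` {t. zf_iter G B t = pverts G}"
    unfolding pt_set_def by (intro Inf_enat_mem) auto
  then obtain t where "zf_iter G B t = pverts G" "pt_set G B = enat t" by auto
  moreover have "B \<noteq> {}" using B k by auto
  ultimately show thesis
    using that[of B t] B k by simp
qed

section \<open>Lower bound for the product\<close>

lemma th_mult_th_complement_ge: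
  assumes G: "G \<in> graphs_of_order n" and "n > 0"
  obtains p where "th G * th (complement G) = enat p" "real n powr (3/2) \<le> 4 * real p"
proof -
  have pg: "pair_graph G" and n: "card (pverts G) = n"
    using G by (auto simp: graphs_of_order_def)
  interpret pair_graph G by fact
  let ?H = "complement G"
  have V: "pverts ?H = pverts G" by (simp add: complement_def)
  have ne: "pverts G \<noteq> {}" using n \<open>n > 0\<close> by auto
  obtain B t where B: "B \<subseteq> pverts G" "B \<noteq> {}" "zf_iter G B t = pverts G"
    "th G = enat (card B + t)"
    using th_attained[OF pair_finite_verts ne] .
  obtain B' t' where B': "B' \<subseteq> pverts G" "B' \<noteq> {}" "zf_iter ?H B' t' = pverts G"
    "th ?H = enat (card B' + t')"
    using th_attained[of ?H] pair_finite_verts ne unfolding V by metis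
  have fin: "finite B" "finite B'"
    by (rule finite_subset[OF B(1) pair_finite_verts] finite_subset[OF B'(1) pair_finite_verts])+
  \<comment> \<open>As k is at least 1, k + ks is at most k^2 + 2ks + s^2.\<close>
  have sqrt_le: "sqrt (real n) \<le> real (k + s)" if "n \<le> k * (1 + s)" "k > 0" for k s
  proof -
    have "k * (1 + s) \<le> k * k + 2 * (k * s) + s * s"
      using that(2) by (cases k) (simp_all add: algebra_simps)
    also have "\<dots> = (k + s)\<^sup>2" by (simp add: power2_eq_square algebra_simps)
    finally have "n \<le> (k + s)\<^sup>2" using that(1) by simp
    then have "real n \<le> (real (k + s))\<^sup>2"
      by (metis of_nat_le_iff of_nat_power)
    then show ?thesis by (intro real_le_lsqrt) auto
  qed
  define a b where "a = card B + t" and "b = card B' + t'"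
  have a: "sqrt (real n) \<le> real a"
    unfolding a_def using card_zf_iter[OF fin(1), of G t] B n fin
    by (intro sqrt_le) (auto simp: card_gt_0_iff)
  have b: "sqrt (real n) \<le> real b"
    unfolding b_def using card_zf_iter[OF fin(2), of ?H t'] B' n fin
    by (intro sqrt_le) (auto simp: card_gt_0_iff)
  have "n \<le> 2 * (card B + card B')"
    using card_zf_sets_complement[OF pg B(1,3) B'(1,3)] n by simp
  \<comment> \<open>One of the two forcing sets has at least n/4 vertices. The factor it belongs to
    supplies n/4, and the other supplies sqrt n.\<close>
  then have "n \<le> 4 * a \<or> n \<le> 4 * b"
    unfolding a_def b_def distrib_left by linarith
  then have "real n \<le> 4 * real a \<or> real n \<le> 4 * real b"
    by linarith
  then have "real n * sqrt (real n) \<le> 4 * (real a * real b)"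
  proof
    assume "real n \<le> 4 * real a"
    then have "real n * sqrt (real n) \<le> (4 * real a) * real b"
      using b by (intro mult_mono) auto
    then show ?thesis by simp
  next
    assume "real n \<le> 4 * real b"
    then have "real n * sqrt (real n) \<le> (4 * real b) * real a"
      using a by (intro mult_mono) auto
    then show ?thesis by (simp add: mult_ac)
  qed
  moreover have "real n powr (3/2) = real n * sqrt (real n)"
    using powr_add[of "real n" 1 "1/2"] by (simp add: powr_half_sqrt)
  ultimately show thesis
    using that[of "a * b"] B(4) B'(4) by (simp add: a_def b_def)
qed

lemma min_prod_ge:
  assumes "n \<ge> 4"
  shows "real n powr (3/2) \<le> 4 * real (the_enat (min_prod n))"
proof -
  have "graphs_of_order n \<noteq> {}"
    using connected_graphs_exist[OF assms] by blast
  then have "min_prod n \<in> (\<lambda>G. th G * th (complement G)) ` graphs_of_order n"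
    unfolding min_prod_def by (intro Inf_enat_mem) auto
  then obtain G where G: "G \<in> graphs_of_order n" "min_prod n = th G * th (complement G)"
    by blast
  then obtain p where "min_prod n = enat p" "real n powr (3/2) \<le> 4 * real p"
    using th_mult_th_complement_ge[OF G(1)] assms by auto
  then show ?thesis by simp
qed

subsection \<open>Paths\<close>

text \<open>The witness inside the proof of \<open>connected_graphs_exist\<close>, named here so
  that its throttling number can be bounded.\<close>

definition path_graph :: "nat \<Rightarrow> nat pair_pre_digraph" where
  "path_graph n = \<lparr> pverts = {..<n},
     parcs = {(i, j). i < n \<and> j < n \<and> (j = Suc i \<or> i = Suc j)} \<rparr>"

lemma path_graph_simps [simp]:
  "pverts (path_graph n) = {..<n}"
  "(i, j) \<in> parcs (path_graph n) \<longleftrightarrow> i < n \<and> j < n \<and> (j = Suc i \<or> i = Suc j)"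
  by (auto simp: path_graph_def)

lemma pair_graph_path_graph: "pair_graph (path_graph n)"
proof -
  have "parcs (path_graph n) \<subseteq> {..<n} \<times> {..<n}" by auto
  then have "finite (parcs (path_graph n))"
    by (meson finite_SigmaI finite_lessThan finite_subset)
  then show ?thesis
    by unfold_locales (auto simp: symmetric_def sym_def)
qed

lemma path_graph_in_graphs_of_order: "path_graph n \<in> graphs_of_order n"
  by (simp add: graphs_of_order_def pair_graph_path_graph)

lemma connected_path_graph:
  assumes "n > 0"
  shows "Digraph_Component.connected (with_proj (path_graph n))"
proof (rule connected_pairI[OF pair_graph_path_graph, of 0])
  interpret pair_graph "path_graph n" by (rule pair_graph_path_graph)
  fix v assume "v \<in> pverts (path_graph n)"
  then show "0 \<rightarrow>\<^sup>*\<^bsub>with_proj (path_graph n)\<^esub> v"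
  proof (induction v)
    case 0
    then show ?case by (intro reachable_refl) auto
  next
    case (Suc v)
    then have "v \<rightarrow>\<^bsub>with_proj (path_graph n)\<^esub> Suc v" by auto
    with Suc show ?case using reachable_adj_trans by auto
  qed
qed (use assms in simp)

lemma connected_complement_path_graph:
  assumes "n \<ge> 4"
  shows "Digraph_Component.connected (with_proj (complement (path_graph n)))"
proof (rule connected_pairI[OF pair_graph_complement[OF pair_graph_path_graph], of 0])
  let ?H = "complement (path_graph n)"
  interpret pair_graph ?H
    by (rule pair_graph_complement[OF pair_graph_path_graph])
  show "0 \<in> pverts ?H" using assms by (simp add: complement_def)
  fix v assume v: "v \<in> pverts ?H"
  then have "v < n" by (simp add: complement_def)
  consider "v = 0" | "v = 1" | "v \<ge> 2" by linarith
  then show "0 \<rightarrow>\<^sup>*\<^bsub>with_proj ?H\<^esub> v"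
  proof cases
    case 1
    then show ?thesis using v reachable_refl by simp
  next
    case 2
    \<comment> \<open>Vertex 1 is the only other vertex not joined to 0 in the complement; the
      detour through 3 uses n \<ge> 4.\<close>
    have arcs: "(0, 3) \<in> parcs ?H" "(3, 1) \<in> parcs ?H"
      using assms by (auto simp: complement_def)
    show ?thesis unfolding 2
      by (rule reachable_adj_trans[OF reachable_adjI[OF arcs(1)] arcs(2)])
  next
    case 3
    then have "0 \<rightarrow>\<^bsub>with_proj ?H\<^esub> v"
      using \<open>v < n\<close> by (auto simp: complement_def)
    then show ?thesis by (intro reachable_adjI) simp
  qed
qed

text \<open>Residues 0 and 1 mark a pair at the start of each block of length \<open>m\<close>. The
  second vertex of a pair has its left neighbour filled, so it forces rightwards, and this repeats
  along the block. Pairs may also force leftwards, hence only an inclusion.\<close>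

lemma zf_iter_path_graph:
  "{v. v < n \<and> v mod m \<le> Suc i} \<subseteq> zf_iter (path_graph n) {v. v < n \<and> v mod m \<le> 1} i"
proof (induction i)
  case (Suc i)
  let ?S = "zf_iter (path_graph n) {v. v < n \<and> v mod m \<le> 1} i"
  show ?case
  proof
    fix v assume v: "v \<in> {v. v < n \<and> v mod m \<le> Suc (Suc i)}"
    show "v \<in> zf_iter (path_graph n) {v. v < n \<and> v mod m \<le> 1} (Suc i)"
    proof (cases "v \<in> ?S")
      case True
      then show ?thesis by (simp add: zf_iter_Suc zf_step_def)
    next
      case False
      then have r: "v mod m = Suc (Suc i)"
        using v Suc.IH by (auto simp: le_Suc_eq)
      then obtain u where u: "v = Suc (Suc u)"
        by (metis mod_0 mod_less_eq_dividend Suc_le_D Suc_le_mono)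
      \<comment> \<open>The residue of \<open>v\<close> is at least 2, so its two predecessors lie
        in the same block.\<close>
      have *: "Suc u mod m = Suc i" "u mod m = i"
        using r unfolding u by (metis mod_Suc Suc_inject nat.distinct(1))+
      then have "Suc u \<in> ?S" "u \<in> ?S"
        using v u Suc.IH by auto
      then have "can_fill (path_graph n) ?S (Suc u) v"
        using v u False unfolding can_fill_def by auto
      then show ?thesis by (auto simp: zf_iter_Suc zf_step_def)
    qed
  qed
qed simp

lemma th_path_graph_le:
  assumes "m > 0" "n > 0" "n \<le> m * m"
  shows "th (path_graph n) \<le> enat (3 * m + 2)"
proof -
  let ?B = "{v. v < n \<and> v mod m \<le> 1}"
  have "zf_iter (path_graph n) ?B m \<subseteq> pverts (path_graph n)"
    by (rule zf_iter_subset[OF pair_graph_path_graph]) auto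
  moreover have "v mod m \<le> Suc m" for v
    using assms by (meson le_SucI mod_le_divisor)
  ultimately have "zf_iter (path_graph n) ?B m = pverts (path_graph n)"
    using zf_iter_path_graph[of n m m] by auto
  moreover have "?B \<noteq> {}" using assms(2) by (auto intro: exI[of _ 0])
  ultimately have "th (path_graph n) \<le> enat (card ?B + m)"
    by (intro th_le[of _ ?B]) auto
  \<comment> \<open>Quotient and remainder encode \<open>?B\<close> injectively. The quotients are
    below \<open>m\<close>; the closed range \<open>{..m}\<close> has m + 1 elements, which gives
    2(m + 1).\<close>
  moreover have "card ?B \<le> 2 * m + 2"
  proof -
    have "(v div m, v mod m) \<in> {..m} \<times> {..1}" if "v \<in> ?B" for v
    proof -
      have "v < m * m" using that assms by simp
      then have "v div m < m" by (simp add: less_mult_imp_div_less)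
      then show ?thesis using that by simp
    qed
    moreover have "inj_on (\<lambda>v. (v div m, v mod m)) ?B"
      by (rule inj_on_inverseI[where g = "\<lambda>(q, r). q * m + r"]) simp
    ultimately have "card ?B \<le> card ({..m} \<times> {..1::nat})"
      by (intro card_inj_on_le) auto
    then show ?thesis by (simp add: card_cartesian_product)
  qed
  ultimately show ?thesis
    by (auto elim!: order_trans)
qed

lemma th_le_order:
  assumes "finite (pverts G)" "pverts G \<noteq> {}"
  shows "th G \<le> enat (card (pverts G))"
  using th_le[OF assms(1) subset_refl assms(2), of 0] by simp

section \<open>Upper bound from paths, and the asymptotics\<close>

lemma min_prod_conn_le:
  assumes "n \<ge> 4"
  shows "real (the_enat (min_prod_conn n)) \<le> 8 * real n powr (3/2)"
proof -
  let ?G = "path_graph n"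
  define m where "m = nat \<lceil>sqrt (real n)\<rceil>"
  have m_ge: "sqrt (real n) \<le> real m"
    unfolding m_def by (rule of_nat_ceiling)
  have m_le: "real m \<le> sqrt (real n) + 1"
    unfolding m_def by (simp add: of_nat_nat)
  have one_le: "1 \<le> sqrt (real n)" using assms by simp
  have "real n = sqrt (real n) * sqrt (real n)" by simp
  also have "\<dots> \<le> real m * real m" using m_ge by (intro mult_mono) auto
  finally have "n \<le> m * m" by (metis of_nat_le_iff of_nat_mult)
  moreover have "m > 0" using m_ge one_le by (cases m) auto
  ultimately have "th ?G \<le> enat (3 * m + 2)"
    using assms by (intro th_path_graph_le) auto
  \<comment> \<open>The trivial bound suffices for the complement: fill every vertex and make no
    step.\<close>
  moreover have "th (complement ?G) \<le> enat n"
    using th_le_order[of "complement ?G"] assms by (auto simp: complement_def lessThan_empty_iff)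
  ultimately have "th ?G * th (complement ?G) \<le> enat (3 * m + 2) * enat n"
    by (rule mult_mono) auto
  moreover have "min_prod_conn n \<le> th ?G * th (complement ?G)"
    unfolding min_prod_conn_def
    using assms path_graph_in_graphs_of_order connected_path_graph connected_complement_path_graph
    by (intro INF_lower) auto
  ultimately have "min_prod_conn n \<le> enat ((3 * m + 2) * n)"
    by simp
  then have "the_enat (min_prod_conn n) \<le> (3 * m + 2) * n"
    by (cases "min_prod_conn n") auto
  then have "real (the_enat (min_prod_conn n)) \<le> real ((3 * m + 2) * n)"
    by (rule of_nat_mono)
  also have "\<dots> = (3 * real m + 2) * real n" by (simp add: algebra_simps)
  also have "\<dots> \<le> (8 * sqrt (real n)) * real n"
  proof (rule mult_right_mono)
    \<comment> \<open>3m + 2 is at most 3 sqrt n + 5, and 5 is at most 5 sqrt n.\<close>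
    show "3 * real m + 2 \<le> 8 * sqrt (real n)"
      using m_le one_le by linarith
  qed simp
  also have "\<dots> = 8 * real n powr (3/2)"
    using powr_add[of "real n" 1 "1/2"] by (simp add: powr_half_sqrt)
  finally show ?thesis .
qed

lemma min_prod_le_min_prod_conn:
  assumes "n \<ge> 4"
  shows "the_enat (min_prod n) \<le> the_enat (min_prod_conn n)"
proof -
  have "min_prod n \<le> min_prod_conn n"
    unfolding min_prod_def min_prod_conn_def by (rule INF_superset_mono) auto
  \<comment> \<open>Passing to \<open>the_enat\<close> preserves the order here because the larger
    value is finite.\<close>
  then show ?thesis
    using min_prod_conn_finite[OF assms] by (cases "min_prod n"; cases "min_prod_conn n") auto
qed

theorem corollary2p8:
  shows "(\<lambda>n. real (the_enat (min_prod n))) \<in> \<Theta>(\<lambda>n. real n powr (3/2)) \<and>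
         (\<lambda>n. real (the_enat (min_prod_conn n))) \<in> \<Theta>(\<lambda>n. real n powr (3/2))"
proof -
  \<comment> \<open>Both functions lie between \<open>min_prod\<close> and
    \<open>min_prod_conn\<close>, so the lower bound for the former (constant 1/4) and the upper
    bound for the latter (constant 8) serve both.\<close>
  have Theta: "f \<in> \<Theta>(\<lambda>n. real n powr (3/2))"
    if "\<And>n. n \<ge> 4 \<Longrightarrow> the_enat (min_prod n) \<le> f n"
      "\<And>n. n \<ge> 4 \<Longrightarrow> f n \<le> the_enat (min_prod_conn n)" for f :: "nat \<Rightarrow> real"
  proof (rule bigthetaI')
    show "\<forall>\<^sub>F n in sequentially. 1/4 * norm (real n powr (3/2)) \<le> norm (f n) \<and>
        norm (f n) \<le> 8 * norm (real n powr (3/2))"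
      using eventually_ge_at_top[of 4]
    proof eventually_elim
      case (elim n)
      then show ?case
        using that[of n] min_prod_ge[of n] min_prod_conn_le[of n] by simp
    qed
  qed auto
  show ?thesis
    by (intro conjI Theta) (auto intro: min_prod_le_min_prod_conn)
qed

end
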